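(* Let $G$ be a real Lie group of dimension $n\ge 3$ with Lie algebra $\mathfrak g$ whose derived algebra $\mathfrak g'=[\mathfrak g,\mathfrak g]$ is two-dimensional, and let $(J,g)$ be a left-invariant almost Hermitian structure on $G$ of Type II, i.e. $J(\mathfrak g')\subseteq\Gamma$, where $\Gamma=(\mathfrak g')^\perp$. Let $\{\mathsf e_1,\mathsf e_2\}$ be an orthonormal basis of $\mathfrak g'$, put $u_0^1=J\mathsf e_1\in\Gamma$ and $u_0^2=J\mathsf e_2\in\Gamma$, and let $\mathsf a_1,\mathsf a_2,\mathsf b_1,\mathsf b_2\in\Gamma$ and $f_1,f_2:\Gamma\to\Gamma$ be the structure data of $\mathfrak g$ with respect to this basis (defined in the context). Then the following statements are equivalent: (1) $(J,g)$ is a Hermitian structure (i.e. $J$ is integrable). (2) $J$ is abelian, i.e. $[Jx,Jy]=[x,y]$ for all $x,y\in\mathfrak g$. (3) The following equations hold: $$\tilde{\mathsf a}_1=Jf_1(u_0^1),\quad \tilde{\mathsf a}_2=Jf_2(u_0^1),\quad \tilde{\mathsf b}_1=Jf_1(u_0^2),\quad \tilde{\mathsf b}_2=Jf_2(u_0^2),$$ $$\langle\mathsf b_1,u_0^1\rangle=\langle\mathsf a_1,u_0^2\rangle,\qquad \langle\mathsf b_2,u_0^1\rangle=\langle\mathsf a_2,u_0^2\rangle,$$ $$\langle f_1(Ju)-Jf_1(u),v\rangle=0,\qquad \langle f_2(Ju)-Jf_2(u),v\rangle=0\qquad\text{for all } u,v\in\Gamma\cap(\mathrm{span}\{u_0^1,u_0^2\})^\perp,$$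 where for $x\in\Gamma$, $\tilde x$ denotes the orthogonal projection of $x$ onto $(\mathrm{span}\{u_0^1,u_0^2\})^\perp$.
   Context: Left-invariant structures are identified with their values on $\mathfrak g$: $g$ corresponds to an inner product $\langle\cdot,\cdot\rangle$ on $\mathfrak g$, and $J$ to a linear map $J:\mathfrak g\to\mathfrak g$ with $J^2=-\mathrm{Id}$. The pair $(J,g)$ is almost Hermitian if $\langle Jx,Jy\rangle=\langle x,y\rangle$ for all $x,y\in\mathfrak g$. It is Hermitian if in addition $J$ is integrable, i.e. $N_J(x,y)=[x,y]+J([Jx,y]+[x,Jy])-[Jx,Jy]=0$ for all $x,y\in\mathfrak g$. Structure data. If $\dim\mathfrak g'=2$ then $\mathfrak g$ is solvable and $\mathfrak g'$ is abelian. Let $\{\mathsf e_1,\mathsf e_2\}$ be an orthonormal basis of $\mathfrak g'$ and $\Gamma$ the orthogonal complement of $\mathfrak g'$ in $\mathfrak g$. There are unique vectors $\mathsf a_1,\mathsf a_2,\mathsf b_1,\mathsf b_2\in\Gamma$ and unique skew-adjoint linear maps $f_1,f_2:\Gamma\to\Gamma$ such that for all $u,v\in\Gamma$ $$[u,\mathsf e_1]=\langle\mathsf a_1,u\rangle\mathsf e_1+\langle\mathsf a_2,u\rangle\mathsf e_2,\qquad [u,\mathsf e_2]=\langle\mathsf b_1,u\rangle\mathsf e_1+\langle\mathsf b_2,u\rangle\mathsf e_2,$$ $$[u,v]=\langle f_1(u),v\rangle\mathsf e_1+\langle f_2(u),v\rangle\mathsf e_2.$$ For a Type II structure, $J$ preserves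 the subspace $\Gamma\cap(\mathrm{span}\{u_0^1,u_0^2\})^\perp$. *)

theory Defs
  imports "HOL-Analysis.Analysis"
begin

text \<open>
  A left-invariant structure on a Lie group is identified with its value on the Lie algebra.
  The Lie algebra with its inner product is a type of class \<open>euclidean_space\<close> (an arbitrary
  finite-dimensional real inner product space), with the bracket \<open>br\<close> as an explicit parameter.
  The library notation \<open>W\<^sup>\<bottom>\<close> denotes the orthogonal complement.
\<close>

definition lie_bracket :: "('a::real_vector \<Rightarrow> 'a \<Rightarrow> 'a) \<Rightarrow> bool" where
  "lie_bracket br \<longleftrightarrow> bilinear br \<and> (\<forall>x. br x x = 0) \<and>
     (\<forall>x y z. br x (br y z) + br y (br z x) + br z (br x y) = 0)"

definition derived_algebra :: "('a::real_vector \<Rightarrow> 'a \<Rightarrow> 'a) \<Rightarrow> 'a set" where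
  "derived_algebra br = span {br x y | x y. True}"

definition Gamma :: "('a::euclidean_space \<Rightarrow> 'a \<Rightarrow> 'a) \<Rightarrow> 'a set" where
  "Gamma br = (derived_algebra br)\<^sup>\<bottom>"

definition almost_hermitian :: "('a::euclidean_space \<Rightarrow> 'a) \<Rightarrow> bool" where
  "almost_hermitian J \<longleftrightarrow> linear J \<and> (\<forall>x. J (J x) = - x) \<and> (\<forall>x y. J x \<bullet> J y = x \<bullet> y)"

definition nijenhuis :: "('a::real_vector \<Rightarrow> 'a \<Rightarrow> 'a) \<Rightarrow> ('a \<Rightarrow> 'a) \<Rightarrow> 'a \<Rightarrow> 'a \<Rightarrow> 'a" where
  "nijenhuis br J x y = br x y + J (br (J x) y + br x (J y)) - br (J x) (J y)"

definition integrable_structure :: "('a::real_vector \<Rightarrow> 'a \<Rightarrow> 'a) \<Rightarrow> ('a \<Rightarrow> 'a) \<Rightarrow> bool" where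
  "integrable_structure br J \<longleftrightarrow> (\<forall>x y. nijenhuis br J x y = 0)"

definition hermitian :: "('a::euclidean_space \<Rightarrow> 'a \<Rightarrow> 'a) \<Rightarrow> ('a \<Rightarrow> 'a) \<Rightarrow> bool" where
  "hermitian br J \<longleftrightarrow> almost_hermitian J \<and> integrable_structure br J"

definition abelian_structure :: "('a::real_vector \<Rightarrow> 'a \<Rightarrow> 'a) \<Rightarrow> ('a \<Rightarrow> 'a) \<Rightarrow> bool" where
  "abelian_structure br J \<longleftrightarrow> (\<forall>x y. br (J x) (J y) = br x y)"

definition type_II :: "('a::euclidean_space \<Rightarrow> 'a \<Rightarrow> 'a) \<Rightarrow> ('a \<Rightarrow> 'a) \<Rightarrow> bool" where
  "type_II br J \<longleftrightarrow> J ` derived_algebra br \<subseteq> Gamma br"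

text \<open>Skew-adjoint linear endomorphisms of a subspace \<open>S\<close>; values outside \<open>S\<close> are irrelevant.\<close>

definition skew_adjoint_on :: "'a::real_inner set \<Rightarrow> ('a \<Rightarrow> 'a) \<Rightarrow> bool" where
  "skew_adjoint_on S f \<longleftrightarrow> f \<in> S \<rightarrow> S \<and>
     (\<forall>u\<in>S. \<forall>v\<in>S. f (u + v) = f u + f v) \<and> (\<forall>c. \<forall>u\<in>S. f (c *\<^sub>R u) = c *\<^sub>R f u) \<and>
     (\<forall>u\<in>S. \<forall>v\<in>S. f u \<bullet> v = - (u \<bullet> f v))"

definition structure_data ::
  "('a::euclidean_space \<Rightarrow> 'a \<Rightarrow> 'a) \<Rightarrow> 'a \<Rightarrow> 'a \<Rightarrow> 'a \<Rightarrow> 'a \<Rightarrow> 'a \<Rightarrow> 'a \<Rightarrow> ('a \<Rightarrow> 'a) \<Rightarrow> ('a \<Rightarrow> 'a) \<Rightarrow> bool"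
  where
  "structure_data br e1 e2 a1 a2 b1 b2 f1 f2 \<longleftrightarrow>
     {a1, a2, b1, b2} \<subseteq> Gamma br \<and> skew_adjoint_on (Gamma br) f1 \<and> skew_adjoint_on (Gamma br) f2 \<and>
     (\<forall>u\<in>Gamma br. br u e1 = (a1 \<bullet> u) *\<^sub>R e1 + (a2 \<bullet> u) *\<^sub>R e2) \<and>
     (\<forall>u\<in>Gamma br. br u e2 = (b1 \<bullet> u) *\<^sub>R e1 + (b2 \<bullet> u) *\<^sub>R e2) \<and>
     (\<forall>u\<in>Gamma br. \<forall>v\<in>Gamma br. br u v = (f1 u \<bullet> v) *\<^sub>R e1 + (f2 u \<bullet> v) *\<^sub>R e2)"

definition orth_proj :: "'a::euclidean_space set \<Rightarrow> 'a \<Rightarrow> 'a" where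
  "orth_proj S x = (THE p. p \<in> S \<and> x - p \<in> S\<^sup>\<bottom>)"

lemma orth_proj_ex1:
  fixes S :: "'a::euclidean_space set"
  assumes "subspace S"
  shows "\<exists>!p. p \<in> S \<and> x - p \<in> S\<^sup>\<bottom>"
proof -
  obtain y z where yz: "y \<in> span S" "\<And>w. w \<in> span S \<Longrightarrow> orthogonal z w" "x = y + z"
    using orthogonal_subspace_decomp_exists by metis
  have S: "span S = S" using assms by (simp add: span_eq_iff)
  show ?thesis
  proof (rule ex1I[of _ y])
    show "y \<in> S \<and> x - y \<in> S\<^sup>\<bottom>"
      using yz S by (auto simp: orthogonal_comp_def orthogonal_commute)
  next
    fix p assume p: "p \<in> S \<and> x - p \<in> S\<^sup>\<bottom>"
    have d: "p - y \<in> S" using p yz(1) S assms by (metis subspace_diff)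
    have "(p - y) \<bullet> (x - p) = 0" "(p - y) \<bullet> z = 0"
      using d p yz(2)[of "p - y"] S
      by (simp_all add: orthogonal_comp_def orthogonal_def inner_commute[of z])
    moreover have "p - y = z - (x - p)" using yz(3) by simp
    ultimately have "(p - y) \<bullet> (p - y) = 0" by (metis diff_zero inner_diff_right)
    then show "p = y" by simp
  qed
qed

lemma orth_proj_mem:
  assumes "subspace S"
  shows "orth_proj S x \<in> S" and "x - orth_proj S x \<in> S\<^sup>\<bottom>"
  using theI'[OF orth_proj_ex1[OF assms]] unfolding orth_proj_def by auto

lemma orth_proj_eqI:
  assumes "subspace S" "p \<in> S" "x - p \<in> S\<^sup>\<bottom>"
  shows "orth_proj S x = p"
  unfolding orth_proj_def using orth_proj_ex1[OF assms(1)] assms(2,3) by blast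

lemma inner_orth_proj:
  assumes "subspace S" "v \<in> S"
  shows "orth_proj S x \<bullet> v = x \<bullet> v"
proof -
  have "v \<bullet> (x - orth_proj S x) = 0"
    using orth_proj_mem(2)[OF assms(1)] assms(2) by (auto simp: orthogonal_comp_def orthogonal_def)
  then show ?thesis by (simp add: inner_diff_right inner_commute)
qed

lemma subspace_Gamma: "subspace (Gamma br)"
  by (simp add: Gamma_def subspace_orthogonal_comp)

text \<open>Existence and uniqueness of the structure data.\<close>

lemma structure_data_exists:
  fixes br :: "'a::euclidean_space \<Rightarrow> 'a \<Rightarrow> 'a"
  assumes br: "lie_bracket br"
    and n: "norm e1 = 1" "norm e2 = 1" "orthogonal e1 e2" and sp: "span {e1, e2} = derived_algebra br"
  shows "\<exists>a1 a2 b1 b2 f1 f2. structure_data br e1 e2 a1 a2 b1 b2 f1 f2"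
proof -
  let ?P = "orth_proj (Gamma br)"
  define A where "A w e = ?P (adjoint (\<lambda>u. br u w) e)" for w e
  define F where "F e u = ?P (adjoint (br u) e)" for e u
  note S = subspace_Gamma[of br]
  have linl: "linear (\<lambda>u. br u w)" and linr: "linear (br u)" for u w
    using br unfolding lie_bracket_def bilinear_def by auto
  have asym: "br y x = - br x y" for x y
  proof -
    have "br (x + y) (x + y) = 0" "br x x = 0" "br y y = 0"
      using br unfolding lie_bracket_def by auto
    then have "br x y + br y x = 0"
      by (simp add: linear_add[OF linl] linear_add[OF linr] add.commute)
    then show ?thesis by (simp add: add_eq_0_iff)
  qed
  have A: "A w e \<bullet> u = br u w \<bullet> e" if "u \<in> Gamma br" for w e u
    using inner_orth_proj[OF S that] adjoint_works[OF linl]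
    by (simp add: A_def inner_commute)
  have F: "F e u \<bullet> v = br u v \<bullet> e" if "v \<in> Gamma br" for e u v
    using inner_orth_proj[OF S that] adjoint_works[OF linr]
    by (simp add: F_def inner_commute)
  have exp: "z = (z \<bullet> e1) *\<^sub>R e1 + (z \<bullet> e2) *\<^sub>R e2" if "z \<in> derived_algebra br" for z
  proof -
    have "z \<in> span (insert e1 {e2})" using that sp by simp
    then obtain p where "z - p *\<^sub>R e1 \<in> span {e2}" by (auto simp: span_breakdown_eq)
    then obtain q where "z - p *\<^sub>R e1 = q *\<^sub>R e2" by (auto simp: span_singleton)
    then have "z = p *\<^sub>R e1 + q *\<^sub>R e2" by (simp add: diff_eq_eq add.commute)
    moreover have "e1 \<bullet> e1 = 1" "e2 \<bullet> e2 = 1" "e1 \<bullet> e2 = 0" "e2 \<bullet> e1 = 0"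
      using n by (auto simp: norm_eq_1 orthogonal_def inner_commute)
    ultimately show ?thesis by (simp add: inner_add_left)
  qed
  have der: "br x y \<in> derived_algebra br" for x y
    unfolding derived_algebra_def by (rule span_base) auto
  have Fin: "F e u \<in> Gamma br" and Ain: "A w e \<in> Gamma br" for e u w
    using orth_proj_mem(1)[OF S] by (auto simp: F_def A_def)
  have eqI: "p = q" if "p \<in> Gamma br" "q \<in> Gamma br" "\<And>v. v \<in> Gamma br \<Longrightarrow> p \<bullet> v = q \<bullet> v" for p q
  proof -
    have "p - q \<in> Gamma br" using that S by (simp add: subspace_diff)
    then have "(p - q) \<bullet> (p - q) = 0" using that(3) by (simp add: inner_diff_left)
    then show ?thesis by simp
  qed
  have skew: "skew_adjoint_on (Gamma br) (F e)" for e
    unfolding skew_adjoint_on_def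
  proof (intro conjI ballI allI)
    fix u v assume u: "u \<in> Gamma br" and v: "v \<in> Gamma br"
    show "F e (u + v) = F e u + F e v"
    proof (rule eqI)
      show "F e u + F e v \<in> Gamma br" by (simp add: Fin S subspace_add)
      fix w assume "w \<in> Gamma br"
      then show "F e (u + v) \<bullet> w = (F e u + F e v) \<bullet> w"
        by (simp add: F inner_add_left linear_add[OF linl])
    qed (rule Fin)
    show "F e u \<bullet> v = - (u \<bullet> F e v)"
      using F[OF v, of e u] F[OF u, of e v] asym[of u v] by (simp add: inner_commute)
  next
    fix c u assume u: "u \<in> Gamma br"
    show "F e (c *\<^sub>R u) = c *\<^sub>R F e u"
    proof (rule eqI)
      show "c *\<^sub>R F e u \<in> Gamma br" by (simp add: Fin S subspace_scale)
      fix w assume "w \<in> Gamma br"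
      then show "F e (c *\<^sub>R u) \<bullet> w = (c *\<^sub>R F e u) \<bullet> w"
        by (simp add: F linear_scale[OF linl])
    qed (rule Fin)
  qed (use Fin in auto)
  have "structure_data br e1 e2 (A e1 e1) (A e1 e2) (A e2 e1) (A e2 e2) (F e1) (F e2)"
    unfolding structure_data_def using skew Ain exp[OF der] A F by auto
  then show ?thesis by blast
qed

lemma structure_data_unique:
  fixes br :: "'a::euclidean_space \<Rightarrow> 'a \<Rightarrow> 'a"
  assumes "norm e1 = 1" "norm e2 = 1" "orthogonal e1 e2"
    and d: "structure_data br e1 e2 a1 a2 b1 b2 f1 f2"
    and d': "structure_data br e1 e2 a1' a2' b1' b2' f1' f2'"
  shows "a1 = a1'" "a2 = a2'" "b1 = b1'" "b2 = b2'"
    "\<And>u. u \<in> Gamma br \<Longrightarrow> f1 u = f1' u" "\<And>u. u \<in> Gamma br \<Longrightarrow> f2 u = f2' u"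
proof -
  have e: "e1 \<bullet> e1 = 1" "e2 \<bullet> e2 = 1" "e1 \<bullet> e2 = 0" "e2 \<bullet> e1 = 0"
    using assms(1-3) by (auto simp: norm_eq_1 orthogonal_def inner_commute)
  have cmp: "p = p' \<and> q = q'" if "p *\<^sub>R e1 + q *\<^sub>R e2 = p' *\<^sub>R e1 + q' *\<^sub>R e2" for p q p' q'
    using arg_cong[OF that, of "\<lambda>z. z \<bullet> e1"] arg_cong[OF that, of "\<lambda>z. z \<bullet> e2"] e
    by (simp add: inner_add_left)
  have eqI: "p = q" if "p \<in> Gamma br" "q \<in> Gamma br" "\<And>v. v \<in> Gamma br \<Longrightarrow> p \<bullet> v = q \<bullet> v" for p q
  proof -
    have "p - q \<in> Gamma br" using that subspace_Gamma by (metis subspace_diff)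
    then have "(p - q) \<bullet> (p - q) = 0" using that(3) by (simp add: inner_diff_left)
    then show ?thesis by simp
  qed
  have in1: "a1 \<in> Gamma br" "a2 \<in> Gamma br" "b1 \<in> Gamma br" "b2 \<in> Gamma br"
    "\<And>u. u \<in> Gamma br \<Longrightarrow> f1 u \<in> Gamma br" "\<And>u. u \<in> Gamma br \<Longrightarrow> f2 u \<in> Gamma br"
    using d unfolding structure_data_def skew_adjoint_on_def by auto
  have in2: "a1' \<in> Gamma br" "a2' \<in> Gamma br" "b1' \<in> Gamma br" "b2' \<in> Gamma br"
    "\<And>u. u \<in> Gamma br \<Longrightarrow> f1' u \<in> Gamma br" "\<And>u. u \<in> Gamma br \<Longrightarrow> f2' u \<in> Gamma br"
    using d' unfolding structure_data_def skew_adjoint_on_def by auto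
  have a: "a1 \<bullet> u = a1' \<bullet> u \<and> a2 \<bullet> u = a2' \<bullet> u" if "u \<in> Gamma br" for u
    by (rule cmp) (use d d' that in \<open>unfold structure_data_def, metis\<close>)
  have b: "b1 \<bullet> u = b1' \<bullet> u \<and> b2 \<bullet> u = b2' \<bullet> u" if "u \<in> Gamma br" for u
    by (rule cmp) (use d d' that in \<open>unfold structure_data_def, metis\<close>)
  have f: "f1 u \<bullet> v = f1' u \<bullet> v \<and> f2 u \<bullet> v = f2' u \<bullet> v" if "u \<in> Gamma br" "v \<in> Gamma br" for u v
    by (rule cmp) (use d d' that in \<open>unfold structure_data_def, metis\<close>)
  show "a1 = a1'" "a2 = a2'" "b1 = b1'" "b2 = b2'" using eqI in1 in2 a b by auto
  show "f1 u = f1' u" "f2 u = f2' u" if "u \<in> Gamma br" for u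
    using eqI in1 in2 f that by auto
qed

end

theory Submission
  imports Defs
begin

text \<open>
  In Type II the values of \<open>br\<close> lie in the derived algebra, while \<open>J\<close> maps the derived algebra into
  its orthogonal complement. Hence the two parts of the Nijenhuis tensor, one without \<open>J\<close> in front
  and one with it, vanish separately, and integrable structures are abelian. The relation
  \<open>br (J x) (J y) = br x y\<close> passes from \<open>(x, y)\<close> to \<open>(y, x)\<close> and to \<open>(J x, J y)\<close>, so it only has to
  be tested on a few pairs from \<open>e1\<close>, \<open>e2\<close>, \<open>J e1\<close>, \<open>J e2\<close> and the \<open>J\<close>-invariant complement of their
  span; on each of these pairs it is one of the equations between the structure data.
\<close>

section \<open>Brackets, orthonormal pairs and the commutativity of the derived algebra\<close>

lemma lie_bracketD:
  assumes "lie_bracket br"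
  shows "linear (\<lambda>x. br x y)" and "linear (br x)" and "br x x = 0"
    and "br x (br y z) + br y (br z x) + br z (br x y) = 0"
  using assms unfolding lie_bracket_def bilinear_def by auto

lemma lie_bracket_skew:
  assumes br: "lie_bracket br"
  shows "br y x = - br x y"
proof -
  note l = lie_bracketD[OF br]
  have "br (x + y) (x + y) = br x x + br x y + (br y x + br y y)"
    by (simp add: linear_add[OF l(1)] linear_add[OF l(2)])
  then have "br x y + br y x = 0" by (simp add: l(3))
  then show ?thesis by (simp add: add_eq_0_iff)
qed

lemma bracket_in_derived_algebra: "br x y \<in> derived_algebra br"
  unfolding derived_algebra_def by (rule span_base) auto

lemma orthonormal_pair_expansion:
  fixes e1 e2 z :: "'a::real_inner"
  assumes "norm e1 = 1" "norm e2 = 1" "orthogonal e1 e2" and z: "z \<in> span {e1, e2}"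
  shows "z = (z \<bullet> e1) *\<^sub>R e1 + (z \<bullet> e2) *\<^sub>R e2"
proof -
  obtain p where "z - p *\<^sub>R e1 \<in> span {e2}"
    using z by (auto simp: span_breakdown_eq)
  then obtain q where "z - p *\<^sub>R e1 = q *\<^sub>R e2" by (auto simp: span_singleton)
  then have "z = p *\<^sub>R e1 + q *\<^sub>R e2" by (simp add: diff_eq_eq add.commute)
  moreover have "e1 \<bullet> e1 = 1" "e2 \<bullet> e2 = 1" "e1 \<bullet> e2 = 0" "e2 \<bullet> e1 = 0"
    using assms by (auto simp: norm_eq_1 orthogonal_def inner_commute)
  ultimately show ?thesis by (simp add: inner_add_left)
qed

lemma in_orthogonal_comp_span_pair:
  "x \<in> (span {u, v})\<^sup>\<bottom> \<longleftrightarrow> x \<bullet> u = 0 \<and> x \<bullet> v = 0"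
proof
  assume "x \<in> (span {u, v})\<^sup>\<bottom>"
  then show "x \<bullet> u = 0 \<and> x \<bullet> v = 0"
    by (auto simp: orthogonal_comp_def orthogonal_def span_base inner_commute)
next
  assume "x \<bullet> u = 0 \<and> x \<bullet> v = 0"
  then have "orthogonal x y" if "y \<in> span {u, v}" for y
    using that by (intro orthogonal_to_span[of y "{u, v}"]) (auto simp: orthogonal_def)
  then show "x \<in> (span {u, v})\<^sup>\<bottom>"
    by (auto simp: orthogonal_comp_def orthogonal_commute)
qed

text \<open>
  On the derived algebra, \<open>ad e1\<close> and \<open>ad e2\<close> have trace zero, being sums of commutators; these
  traces are the coordinates of \<open>br e1 e2\<close> up to sign.
\<close>

lemma two_dim_derived_algebra_abelian:
  fixes br :: "'a::real_inner \<Rightarrow> 'a \<Rightarrow> 'a"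
  assumes br: "lie_bracket br"
    and e: "norm e1 = 1" "norm e2 = 1" "orthogonal e1 e2" and sp: "span {e1, e2} = derived_algebra br"
  shows "br e1 e2 = 0"
proof -
  note l = lie_bracketD[OF br]
  note skew = lie_bracket_skew[OF br]
  note lin = linear_add[OF l(1)] linear_add[OF l(2)] linear_scale[OF l(1)] linear_scale[OF l(2)]
    linear_0[OF l(1)] linear_diff[OF l(1)]
  have exp: "br x y = (br x y \<bullet> e1) *\<^sub>R e1 + (br x y \<bullet> e2) *\<^sub>R e2" for x y
    using orthonormal_pair_expansion[OF e, of "br x y"] bracket_in_derived_algebra[of br x y] sp by simp
  define t where "t x = br x e1 \<bullet> e1 + br x e2 \<bullet> e2" for x
  have jac: "br (br x y) z = br x (br y z) - br y (br x z)" for x y z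
  proof -
    have "br y (br z x) = - br y (br x z)"
      using skew[of z x] linear_neg[OF l(2)] by simp
    then have "br x (br y z) - br y (br x z) - br (br x y) z = 0"
      using l(4)[of x y z] skew[of z "br x y"] by simp
    then show ?thesis by simp
  qed
  \<comment> \<open>\<open>br y z\<close> has coordinates in \<open>e1\<close>, \<open>e2\<close>,
    so for \<open>z\<close> and \<open>w\<close> among these two vectors this is an entry of a
    product of 2x2 matrices.\<close>
  have coord: "br x (br y z) \<bullet> w = (br y z \<bullet> e1) * (br x e1 \<bullet> w) + (br y z \<bullet> e2) * (br x e2 \<bullet> w)"
    for x y z w
    by (subst exp[of y z]) (simp add: lin inner_add_left)
  \<comment> \<open>By \<open>jac\<close> this is the trace of a commutator: products of diagonal
    entries cancel within each summand of \<open>t\<close>, mixed products cancel across the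
    two.\<close>
  have t0: "t (br x y) = 0" for x y
    unfolding t_def jac inner_diff_left coord by (simp add: algebra_simps)
  have "subspace {x. t x = 0}"
    by (auto simp: subspace_def t_def lin inner_add_left simp flip: distrib_left)
  then have "derived_algebra br \<subseteq> {x. t x = 0}"
    unfolding derived_algebra_def by (intro span_minimal) (auto simp: t0)
  moreover have "e1 \<in> derived_algebra br" "e2 \<in> derived_algebra br"
    using sp by (auto simp flip: sp intro: span_base)
  ultimately have "t e1 = 0" "t e2 = 0" by auto
  then have "br e1 e2 \<bullet> e1 = 0" "br e1 e2 \<bullet> e2 = 0"
    using lie_bracket_skew[OF br, of e2 e1] by (auto simp: t_def l(3))
  then show ?thesis using exp[of e1 e2] by simp
qed

section \<open>Integrable versus abelian structures\<close>

lemma abelian_imp_integrable_structure: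
  assumes br: "lie_bracket br" and J: "linear J" "\<And>x. J (J x) = - x"
    and ab: "abelian_structure br J"
  shows "integrable_structure br J"
proof -
  \<comment> \<open>The abelian condition at \<open>(x, J y)\<close> makes the two terms under
    \<open>J\<close> in the Nijenhuis tensor cancel; at \<open>(x, y)\<close> it cancels the other
    two.\<close>
  have "br x (J y) = - br (J x) y" for x y
  proof -
    have "br x (J y) = br (J x) (J (J y))"
      using ab by (simp add: abelian_structure_def)
    also have "\<dots> = - br (J x) y"
      by (simp add: J(2) linear_neg[OF lie_bracketD(2)[OF br]])
    finally show ?thesis .
  qed
  then show ?thesis
    using ab by (simp add: integrable_structure_def nijenhuis_def abelian_structure_def linear_0[OF J(1)])
qed

lemma type_II_integrable_imp_abelian:
  fixes br :: "'a::euclidean_space \<Rightarrow> 'a \<Rightarrow> 'a"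
  assumes tII: "type_II br J" and int: "integrable_structure br J"
  shows "abelian_structure br J"
  unfolding abelian_structure_def
proof (intro allI)
  fix x y
  let ?D = "derived_algebra br"
  \<comment> \<open>\<open>d + J s\<close> is the Nijenhuis tensor, with \<open>d\<close> in the
    derived algebra and \<open>J s\<close> orthogonal to it. Its vanishing gives
    \<open>J s = - d\<close>, so \<open>d\<close> is orthogonal to itself.\<close>
  define d where "d = br x y - br (J x) (J y)"
  define s where "s = br (J x) y + br x (J y)"
  have D: "subspace ?D" by (simp add: derived_algebra_def)
  have d: "d \<in> ?D" and s: "s \<in> ?D"
    unfolding d_def s_def using bracket_in_derived_algebra
    by (auto intro: subspace_diff[OF D] subspace_add[OF D])
  have "J s \<in> ?D\<^sup>\<bottom>" using tII s by (auto simp: type_II_def Gamma_def)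
  then have "d \<bullet> J s = 0" using d by (auto simp: orthogonal_comp_def orthogonal_def)
  moreover have "d + J s = 0"
    using int unfolding integrable_structure_def nijenhuis_def d_def s_def
    by (metis add_diff_eq add.commute diff_add_eq)
  then have "J s = - d" by (simp add: add_eq_0_iff)
  ultimately have "d = 0" by simp
  then show "br (J x) (J y) = br x y" by (simp add: d_def)
qed

text \<open>Both sides of the abelian condition are bilinear, so agreement on a spanning set
  suffices. Skew symmetry and \<open>J (J x) = - x\<close> settle the pairs \<open>(x, x)\<close>
  and \<open>(x, J x)\<close>; the listed pairs produce all the others.\<close>

lemma abelian_structure_iff_generators:
  fixes br :: "'a::real_vector \<Rightarrow> 'a \<Rightarrow> 'a"
  assumes br: "lie_bracket br" and J: "linear J" "\<And>x. J (J x) = - x"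
    and W: "\<And>w. w \<in> W \<Longrightarrow> J w \<in> W"
    and sp: "span ({e1, e2, J e1, J e2} \<union> W) = UNIV"
  shows "abelian_structure br J \<longleftrightarrow>
    br (J e1) (J e2) = br e1 e2 \<and> br (J e1) (J (J e2)) = br e1 (J e2) \<and>
    (\<forall>w\<in>W. br (J e1) (J w) = br e1 w \<and> br (J e2) (J w) = br e2 w) \<and>
    (\<forall>w\<in>W. \<forall>v\<in>W. br (J w) (J v) = br w v)"
    (is "_ \<longleftrightarrow> ?R")
proof
  assume "abelian_structure br J"
  then show ?R by (simp add: abelian_structure_def)
next
  assume R: ?R
  note l = lie_bracketD[OF br]
  note neg = linear_neg[OF l(1)] linear_neg[OF l(2)] linear_neg[OF J(1)]
  define P where "P x y \<longleftrightarrow> br (J x) (J y) = br x y" for x y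
  have sym: "P y x" if "P x y" for x y
    using that lie_bracket_skew[OF br] unfolding P_def by metis
  have PJ: "P (J x) (J y)" if "P x y" for x y
    using that by (simp add: P_def J(2) neg)
  have refl: "P x x" for x by (simp add: P_def l(3))
  have PxJx: "P x (J x)" for x
    using lie_bracket_skew[OF br, of x "J x"] by (simp add: P_def J(2) neg)
  have e: "P e1 e2" "P e1 (J e2)" "\<And>w. w \<in> W \<Longrightarrow> P e1 w" "\<And>w. w \<in> W \<Longrightarrow> P e2 w"
    "\<And>w v. w \<in> W \<Longrightarrow> v \<in> W \<Longrightarrow> P w v"
    using R by (auto simp: P_def)
  \<comment> \<open>\<open>PJ\<close> sends the pair \<open>(e1, J e2)\<close> to
    \<open>(J e1, - e2)\<close>; linearity removes the sign and skew symmetry swaps the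
    entries.\<close>
  have e2J1: "P e2 (J e1)"
    using PJ[OF e(2)] lie_bracket_skew[OF br, of e2 "J e1"] lie_bracket_skew[OF br, of "J e2" e1]
    by (simp add: P_def J(2) neg)
  \<comment> \<open>This is \<open>P x (J w)\<close> with both sides negated; \<open>J w\<close> is
    an admissible test vector because \<open>W\<close> is \<open>J\<close>-invariant.\<close>
  have Jw: "P (J x) w" if "\<And>w. w \<in> W \<Longrightarrow> P x w" "w \<in> W" for x w
    using that(1)[OF W[OF that(2)]] minus_equation_iff[of "br (J x) w"] by (simp add: P_def J(2) neg)
  have gen: "P x y" if "x \<in> {e1, e2, J e1, J e2} \<union> W" "y \<in> {e1, e2, J e1, J e2} \<union> W" for x y
    using that refl e e2J1 PxJx PJ[OF e(1)] Jw[of e1] Jw[of e2]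
    by (auto intro: sym)
  have "bilinear (\<lambda>x y. br (J x) (J y))"
    unfolding bilinear_def
    using linear_compose[OF J(1) l(1)] linear_compose[OF J(1) l(2)] by (auto simp: o_def)
  moreover have "bilinear br" using br by (simp add: lie_bracket_def)
  ultimately have "br (J x) (J y) = br x y" for x y
    using bilinear_eq[of "\<lambda>x y. br (J x) (J y)" br UNIV "{e1, e2, J e1, J e2} \<union> W" UNIV
        "{e1, e2, J e1, J e2} \<union> W" x y] gen sp
    by (auto simp: P_def)
  then show "abelian_structure br J" by (simp add: abelian_structure_def)
qed

theorem theorem2p9:
  fixes br :: "'a::euclidean_space \<Rightarrow> 'a \<Rightarrow> 'a" and J :: "'a \<Rightarrow> 'a"
    and e1 e2 u01 u02 a1 a2 b1 b2 :: 'a and f1 f2 :: "'a \<Rightarrow> 'a"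
    and proj :: "'a \<Rightarrow> 'a"
  assumes "DIM('a) \<ge> 3"
    and "lie_bracket br"
    and "dim (derived_algebra br) = 2"
    and "almost_hermitian J"
    and "type_II br J"
    and "norm e1 = 1" and "norm e2 = 1" and "orthogonal e1 e2"
    and "span {e1, e2} = derived_algebra br"
    and "u01 = J e1" and "u02 = J e2"
    and "structure_data br e1 e2 a1 a2 b1 b2 f1 f2"
    and "proj = orth_proj ((span {u01, u02})\<^sup>\<bottom>)"
  shows "(hermitian br J \<longleftrightarrow> abelian_structure br J) \<and>
    (abelian_structure br J \<longleftrightarrow>
      proj a1 = J (f1 u01) \<and> proj a2 = J (f2 u01) \<and>
      proj b1 = J (f1 u02) \<and> proj b2 = J (f2 u02) \<and>
      b1 \<bullet> u01 = a1 \<bullet> u02 \<and> b2 \<bullet> u01 = a2 \<bullet> u02 \<and>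
      (\<forall>u \<in> Gamma br \<inter> (span {u01, u02})\<^sup>\<bottom>. \<forall>v \<in> Gamma br \<inter> (span {u01, u02})\<^sup>\<bottom>.
        (f1 (J u) - J (f1 u)) \<bullet> v = 0 \<and> (f2 (J u) - J (f2 u)) \<bullet> v = 0))"
proof -
  note br = assms(2) and tII = assms(5) and e = assms(6-8) and sp = assms(9) and proj = assms(13)
  have J: "linear J" "\<And>x. J (J x) = - x" "\<And>x y. J x \<bullet> J y = x \<bullet> y"
    using assms(4) by (auto simp: almost_hermitian_def)
  note l = lie_bracketD[OF br]
  note skew = lie_bracket_skew[OF br]
  have u: "J e1 = u01" "J e2 = u02" "J u01 = - e1" "J u02 = - e2"
    using assms(10,11) J(2) by auto
  have J_skew: "J x \<bullet> y = - (x \<bullet> J y)" for x y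
    using J(3)[of x "J y"] J(2)[of y] by simp
  have ee: "e1 \<bullet> e1 = 1" "e2 \<bullet> e2 = 1" "e1 \<bullet> e2 = 0" "e2 \<bullet> e1 = 0"
    using e by (auto simp: norm_eq_1 orthogonal_def inner_commute)

  \<comment> \<open>The orthogonal complement \<open>W\<close> of \<open>e1\<close>,
    \<open>e2\<close>, \<open>J e1\<close>, \<open>J e2\<close>\<close>
  define G where "G = Gamma br"
  define U where "U = (span {u01, u02})\<^sup>\<bottom>"
  define W where "W = G \<inter> U"
  have G_iff: "x \<in> G \<longleftrightarrow> x \<bullet> e1 = 0 \<and> x \<bullet> e2 = 0" for x
    unfolding G_def Gamma_def sp[symmetric] by (rule in_orthogonal_comp_span_pair)
  have U_iff: "x \<in> U \<longleftrightarrow> x \<bullet> u01 = 0 \<and> x \<bullet> u02 = 0" for x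
    unfolding U_def by (rule in_orthogonal_comp_span_pair)
  have U: "subspace U" by (simp add: U_def subspace_orthogonal_comp)
  have "e1 \<in> derived_algebra br" "e2 \<in> derived_algebra br"
    by (auto simp flip: sp intro: span_base)
  then have uG: "u01 \<in> G" "u02 \<in> G"
    using tII u by (auto simp: type_II_def G_def)
  have eU: "e1 \<in> U" "e2 \<in> U"
    using uG by (auto simp: U_iff G_iff inner_commute)
  \<comment> \<open>\<open>J\<close> is skew-adjoint and permutes \<open>e1\<close>,
    \<open>e2\<close>, \<open>u01\<close>, \<open>u02\<close> up to sign, so it preserves their
    orthogonal complement.\<close>
  have WJ: "J w \<in> W" if "w \<in> W" for w
    using that by (auto simp: W_def G_iff U_iff J_skew u)
  have span_UNIV: "span ({e1, e2, J e1, J e2} \<union> W) = UNIV"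
  proof -
    have "x \<in> span ({e1, e2, J e1, J e2} \<union> W)" for x
    proof -
      obtain y z where y: "y \<in> span {e1, e2, J e1, J e2}"
        and z: "\<And>w. w \<in> span {e1, e2, J e1, J e2} \<Longrightarrow> orthogonal z w" and x: "x = y + z"
        using orthogonal_subspace_decomp_exists by metis
      have "z \<in> W"
        using z[OF span_base] by (simp add: W_def G_iff U_iff orthogonal_def u)
      then show ?thesis
        unfolding x using y by (meson Un_iff span_add span_base span_mono subsetD sup_ge1)
    qed
    then show ?thesis by auto
  qed

  \<comment> \<open>The abelian condition in terms of the structure data\<close>
  have sd: "a1 \<in> G" "a2 \<in> G" "b1 \<in> G" "b2 \<in> G"
    "skew_adjoint_on G f1" "skew_adjoint_on G f2"
    and bre: "\<And>x. x \<in> G \<Longrightarrow> br x e1 = (a1 \<bullet> x) *\<^sub>R e1 + (a2 \<bullet> x) *\<^sub>R e2"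
      "\<And>x. x \<in> G \<Longrightarrow> br x e2 = (b1 \<bullet> x) *\<^sub>R e1 + (b2 \<bullet> x) *\<^sub>R e2"
    and brG: "\<And>x y. x \<in> G \<Longrightarrow> y \<in> G \<Longrightarrow> br x y = (f1 x \<bullet> y) *\<^sub>R e1 + (f2 x \<bullet> y) *\<^sub>R e2"
    using assms(12) by (auto simp: structure_data_def G_def)
  have fG: "f1 x \<in> G" "f2 x \<in> G" if "x \<in> G" for x
    using sd(5,6) that by (auto simp: skew_adjoint_on_def)
  have f_skew: "f1 x \<bullet> y = - (f1 y \<bullet> x)" "f2 x \<bullet> y = - (f2 y \<bullet> x)" if "x \<in> G" "y \<in> G" for x y
    using sd(5,6) that inner_commute unfolding skew_adjoint_on_def by metis+
  have f_null: "f1 x \<bullet> x = 0" "f2 x \<bullet> x = 0" if "x \<in> G" for x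
    using f_skew[OF that that] by (simp_all only: equal_neg_zero)
  have cmp: "p *\<^sub>R e1 + q *\<^sub>R e2 = p' *\<^sub>R e1 + q' *\<^sub>R e2 \<longleftrightarrow> p = p' \<and> q = q'" for p q p' q'
  proof
    assume *: "p *\<^sub>R e1 + q *\<^sub>R e2 = p' *\<^sub>R e1 + q' *\<^sub>R e2"
    show "p = p' \<and> q = q'"
      using arg_cong[OF *, of "\<lambda>z. z \<bullet> e1"] arg_cong[OF *, of "\<lambda>z. z \<bullet> e2"]
      by (simp add: inner_add_left ee)
  qed simp
  \<comment> \<open>The right-hand conditions \<open>c \<bullet> u01 = c \<bullet> u02 = 0\<close> say that \<open>J c\<close> lies in \<open>Gamma br\<close>, as the
    projection of \<open>a\<close> does.\<close>
  have proj_iff: "proj a = J c \<longleftrightarrow> (\<forall>w\<in>W. a \<bullet> w = J c \<bullet> w) \<and> c \<bullet> u01 = 0 \<and> c \<bullet> u02 = 0"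
    if a: "a \<in> G" and c: "c \<in> G" for a c
  proof
    assume *: "proj a = J c"
    have i: "J c \<bullet> v = a \<bullet> v" if "v \<in> U" for v
      using inner_orth_proj[OF U that, of a] * proj by (simp add: U_def)
    \<comment> \<open>Type II puts \<open>e1\<close> and \<open>e2\<close> into \<open>U\<close>, so
      they may serve as test vectors; \<open>a\<close> is orthogonal to both.\<close>
    have "J c \<bullet> e1 = 0" "J c \<bullet> e2 = 0"
      using i[OF eU(1)] i[OF eU(2)] a by (auto simp: G_iff)
    then show "(\<forall>w\<in>W. a \<bullet> w = J c \<bullet> w) \<and> c \<bullet> u01 = 0 \<and> c \<bullet> u02 = 0"
      using i by (auto simp: W_def J_skew u)
  next
    assume *: "(\<forall>w\<in>W. a \<bullet> w = J c \<bullet> w) \<and> c \<bullet> u01 = 0 \<and> c \<bullet> u02 = 0"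
    have "orth_proj U a = J c"
    proof (rule orth_proj_eqI[OF U])
      show "J c \<in> U" using c by (simp add: U_iff G_iff J_skew u)
      have "(a - J c) \<bullet> v = 0" if v: "v \<in> U" for v
      proof -
        \<comment> \<open>Subtracting the component in the derived algebra leaves a vector of
          \<open>W\<close>, where the hypothesis applies. On \<open>e1\<close> and
          \<open>e2\<close>, \<open>a\<close> vanishes since it lies in \<open>G\<close>, and
          \<open>J c\<close> since \<open>c\<close> is orthogonal to \<open>u01\<close> and
          \<open>u02\<close>.\<close>
        define w where "w = v - ((v \<bullet> e1) *\<^sub>R e1 + (v \<bullet> e2) *\<^sub>R e2)"
        have "w \<in> U"
          unfolding w_def by (intro subspace_diff subspace_add subspace_scale U v eU)
        moreover have "w \<in> G"
          by (simp add: G_iff w_def inner_diff_left inner_add_left ee)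
        ultimately have "(a - J c) \<bullet> w = 0"
          using * by (simp add: W_def inner_diff_left)
        moreover have "(a - J c) \<bullet> e1 = 0" "(a - J c) \<bullet> e2 = 0"
          using a * by (auto simp: inner_diff_left G_iff J_skew u)
        ultimately show ?thesis
          by (simp add: w_def inner_diff_right inner_add_right)
      qed
      then show "a - J c \<in> U\<^sup>\<bottom>"
        by (auto simp: orthogonal_comp_def orthogonal_def inner_commute)
    qed
    then show "proj a = J c" using proj by (simp add: U_def)
  qed
  \<comment> \<open>Condition (3) does not list these two equations: by \<open>proj_iff\<close> they
    are contained in the projection equations for \<open>a1\<close> and \<open>a2\<close>.\<close>
  have e12: "br (J e1) (J e2) = br e1 e2 \<longleftrightarrow> f1 u01 \<bullet> u02 = 0 \<and> f2 u01 \<bullet> u02 = 0"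
    using cmp[of _ _ 0 0] by (simp add: two_dim_derived_algebra_abelian[OF br e sp] u brG uG)
  \<comment> \<open>Up to a common sign the two sides are \<open>br u01 e2\<close> and
    \<open>br u02 e1\<close>, both read off from the structure data.\<close>
  have e1u2: "br (J e1) (J (J e2)) = br e1 (J e2) \<longleftrightarrow>
      b1 \<bullet> u01 = a1 \<bullet> u02 \<and> b2 \<bullet> u01 = a2 \<bullet> u02"
    using skew[of e1 u02] cmp by (simp add: u linear_neg[OF l(2)] bre uG del: minus_add_distrib)
  \<comment> \<open>Swapping the arguments of \<open>br e1 w\<close> and moving \<open>J\<close>
    across the inner product each cost a sign, so the signs cancel.\<close>
  have ew: "br (J e1) (J w) = br e1 w \<longleftrightarrow> a1 \<bullet> w = J (f1 u01) \<bullet> w \<and> a2 \<bullet> w = J (f2 u01) \<bullet> w"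
    "br (J e2) (J w) = br e2 w \<longleftrightarrow> b1 \<bullet> w = J (f1 u02) \<bullet> w \<and> b2 \<bullet> w = J (f2 u02) \<bullet> w"
    if w: "w \<in> W" for w
  proof -
    have wG: "w \<in> G" "J w \<in> G" using w WJ by (auto simp: W_def)
    have "br e1 w = (- (a1 \<bullet> w)) *\<^sub>R e1 + (- (a2 \<bullet> w)) *\<^sub>R e2"
      "br e2 w = (- (b1 \<bullet> w)) *\<^sub>R e1 + (- (b2 \<bullet> w)) *\<^sub>R e2"
      using skew[of e1 w] skew[of e2 w] by (simp_all add: bre wG)
    then show "br (J e1) (J w) = br e1 w \<longleftrightarrow> a1 \<bullet> w = J (f1 u01) \<bullet> w \<and> a2 \<bullet> w = J (f2 u01) \<bullet> w"
      "br (J e2) (J w) = br e2 w \<longleftrightarrow> b1 \<bullet> w = J (f1 u02) \<bullet> w \<and> b2 \<bullet> w = J (f2 u02) \<bullet> w"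
      by (auto simp only: u brG[OF uG(1) wG(2)] brG[OF uG(2) wG(2)] cmp J_skew)
  qed
  have ww: "(\<forall>w\<in>W. \<forall>v\<in>W. br (J w) (J v) = br w v) \<longleftrightarrow>
      (\<forall>w\<in>W. \<forall>v\<in>W. (f1 (J w) - J (f1 w)) \<bullet> v = 0 \<and> (f2 (J w) - J (f2 w)) \<bullet> v = 0)"
    (is "?L \<longleftrightarrow> ?R")
  proof -
    \<comment> \<open>With \<open>J v\<close> as second argument, the left side pairs
      \<open>f1 (J w)\<close> with \<open>- v\<close>, and the right side pairs \<open>f1 w\<close>
      with \<open>J v\<close>, where skewness moves \<open>J\<close> onto
      \<open>f1 w\<close>.\<close>
    have *: "br (J w) (J (J v)) = br w (J v) \<longleftrightarrow>
        (f1 (J w) - J (f1 w)) \<bullet> v = 0 \<and> (f2 (J w) - J (f2 w)) \<bullet> v = 0"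
      if "w \<in> W" "v \<in> W" for w v
    proof -
      have wG: "w \<in> G" "J w \<in> G" "J v \<in> G" "J (J v) \<in> G"
        using that WJ by (auto simp: W_def)
      show ?thesis
        unfolding brG[OF wG(2,4)] brG[OF wG(1,3)] cmp
        by (auto simp: J(2) inner_diff_left J_skew)
    qed
    \<comment> \<open>Since \<open>J (J v) = - v\<close>, \<open>J\<close> maps \<open>W\<close>
      onto itself, so testing on all \<open>J v\<close> is the same as testing on all
      \<open>v\<close>.\<close>
    have "?L \<longleftrightarrow> (\<forall>w\<in>W. \<forall>v\<in>W. br (J w) (J (J v)) = br w (J v))"
    proof
      assume r: "\<forall>w\<in>W. \<forall>v\<in>W. br (J w) (J (J v)) = br w (J v)"
      show ?L
      proof (intro ballI)
        fix w v assume wv: "w \<in> W" "v \<in> W"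
        have "br (J w) (J (J (J v))) = br w (J (J v))" using r wv WJ by blast
        then show "br (J w) (J v) = br w v"
          by (simp add: J(2) linear_neg[OF J(1)] linear_neg[OF l(2)])
      qed
    qed (use WJ in blast)
    then show ?thesis using * by simp
  qed
  have gen: "abelian_structure br J \<longleftrightarrow>
      br (J e1) (J e2) = br e1 e2 \<and> br (J e1) (J (J e2)) = br e1 (J e2) \<and>
      (\<forall>w\<in>W. br (J e1) (J w) = br e1 w \<and> br (J e2) (J w) = br e2 w) \<and>
      (\<forall>w\<in>W. \<forall>v\<in>W. br (J w) (J v) = br w v)"
    by (rule abelian_structure_iff_generators[OF br J(1,2) _ span_UNIV]) (fact WJ)
  \<comment> \<open>The \<open>W\<close>-parts of the projection equations match \<open>ew\<close>.
    Of the remaining conditions, \<open>f_null\<close> disposes of those with equal arguments, and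
    \<open>f_skew\<close> reduces the ones from \<open>b1\<close>, \<open>b2\<close> to those in
    \<open>e12\<close>.\<close>
  have "abelian_structure br J \<longleftrightarrow>
      proj a1 = J (f1 u01) \<and> proj a2 = J (f2 u01) \<and>
      proj b1 = J (f1 u02) \<and> proj b2 = J (f2 u02) \<and>
      b1 \<bullet> u01 = a1 \<bullet> u02 \<and> b2 \<bullet> u01 = a2 \<bullet> u02 \<and>
      (\<forall>u\<in>W. \<forall>v\<in>W. (f1 (J u) - J (f1 u)) \<bullet> v = 0 \<and> (f2 (J u) - J (f2 u)) \<bullet> v = 0)"
    unfolding gen e12 e1u2 ww
      proj_iff[OF sd(1) fG(1)[OF uG(1)]] proj_iff[OF sd(2) fG(2)[OF uG(1)]]
      proj_iff[OF sd(3) fG(1)[OF uG(2)]] proj_iff[OF sd(4) fG(2)[OF uG(2)]]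
    by (auto simp: ew f_null[OF uG(1)] f_null[OF uG(2)] f_skew[OF uG(2,1)])
  moreover have "hermitian br J \<longleftrightarrow> abelian_structure br J"
    using type_II_integrable_imp_abelian[OF tII] abelian_imp_integrable_structure[OF br J(1,2)] assms(4)
    by (auto simp: hermitian_def)
  ultimately show ?thesis unfolding W_def G_def U_def by blast
qed

end
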